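(* Let $G$ and $H$ be two non-trivial groups and let $C$ be a proper subgroup of the free product $G*H$. If $C$ has finite Kurosh rank with respect to $G*H$, then there exist a finite set $\Omega\subseteq G*H$ and finite families $\{\zeta_i\}_{i\in I},\{\alpha_j\}_{j\in J},\{\beta_k\}_{k\in K}\subseteq G*H$ (with $I,J,K$ finite) satisfying the following property: for every subgroup $G_0$ of $G$ and every subgroup $H_0$ of $H$ satisfying $\Omega\subseteq\langle G_0,H_0\rangle$, there exist a subgroup $G_j$ of $G_0$ for each $j\in J$ and a subgroup $H_k$ of $H_0$ for each $k\in K$ such that $$C\cap\langle G_0,H_0\rangle=\Big\langle \{\zeta_i : i\in I\}\cup\Big(\bigcup_{j\in J}\alpha_jG_j\alpha_j^{-1}\Big)\cup\Big(\bigcup_{k\in K}\beta_kH_k\beta_k^{-1}\Big)\Big\rangle .$$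
   Context: Here $\langle S\rangle$ denotes the subgroup generated by $S$ and $\langle G_0,H_0\rangle$ is the subgroup of $G*H$ generated by $G_0\cup H_0$. Kurosh rank: by Kurosh's theorem, a subgroup $C$ of $G*H$ decomposes as $C=\mathbb{F}*\big(\ast_x\, C\cap xGx^{-1}\big)*\big(\ast_y\, C\cap yHy^{-1}\big)$, where $\mathbb{F}$ is a free subgroup, $x$ ranges over a (suitable) set of representatives of the double cosets $C\backslash(G*H)/G$ and $y$ over a (suitable) set of representatives of $C\backslash(G*H)/H$. The Kurosh rank of $C$ with respect to $G*H$ is the free rank of $\mathbb{F}$ plus the number of non-trivial factors $C\cap xGx^{-1}$ and $C\cap yHy^{-1}$; it may be infinite and does not depend on the chosen decomposition. *)

theory Defs
  imports "HOL-Algebra.Generated_Groups" "HOL-Library.Extended_Nat"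
begin

text \<open>
  The free product is realised on normal forms: lists of non-trivial elements of the two
  factors in which the factors alternate.  The product of two normal forms is obtained by
  prepending the syllables of the first one to the second one, from the last syllable to the
  first one, merging or cancelling neighbours that come from the same factor.
\<close>

fun syllable_cons ::
  "('a, 'm) monoid_scheme \<Rightarrow> ('b, 'n) monoid_scheme \<Rightarrow> 'a + 'b \<Rightarrow> ('a + 'b) list \<Rightarrow> ('a + 'b) list"
where
  "syllable_cons G H (Inl g) (Inl g' # w) =
     (if g \<otimes>\<^bsub>G\<^esub> g' = \<one>\<^bsub>G\<^esub> then w else Inl (g \<otimes>\<^bsub>G\<^esub> g') # w)"
| "syllable_cons G H (Inr h) (Inr h' # w) =
     (if h \<otimes>\<^bsub>H\<^esub> h' = \<one>\<^bsub>H\<^esub> then w else Inr (h \<otimes>\<^bsub>H\<^esub> h') # w)"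
| "syllable_cons G H s w = s # w"

definition free_product ::
  "('a, 'm) monoid_scheme \<Rightarrow> ('b, 'n) monoid_scheme \<Rightarrow> ('a + 'b) list monoid"
where
  "free_product G H =
     \<lparr>carrier = {w. set w \<subseteq> (carrier G - {\<one>\<^bsub>G\<^esub>}) <+> (carrier H - {\<one>\<^bsub>H\<^esub>}) \<and>
                    successively (\<lambda>s t. isl s \<noteq> isl t) w},
      mult = foldr (syllable_cons G H),
      one = []\<rparr>"

definition left_embed :: "('a, 'm) monoid_scheme \<Rightarrow> 'a \<Rightarrow> ('a + 'b) list" where
  "left_embed G g = (if g = \<one>\<^bsub>G\<^esub> then [] else [Inl g])"

definition right_embed :: "('b, 'n) monoid_scheme \<Rightarrow> 'b \<Rightarrow> ('a + 'b) list" where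
  "right_embed H h = (if h = \<one>\<^bsub>H\<^esub> then [] else [Inr h])"

definition conj_set :: "('g, 'm) monoid_scheme \<Rightarrow> 'g \<Rightarrow> 'g set \<Rightarrow> 'g set" where
  "conj_set P x S = (\<lambda>s. x \<otimes>\<^bsub>P\<^esub> s \<otimes>\<^bsub>P\<^esub> inv\<^bsub>P\<^esub> x) ` S"

definition list_mult :: "('g, 'm) monoid_scheme \<Rightarrow> 'g list \<Rightarrow> 'g" where
  "list_mult P xs = foldr (mult P) xs \<one>\<^bsub>P\<^esub>"

text \<open>
  The subgroup \<open>F\<close> is free with free basis \<open>B\<close>: a letter \<open>(b, True)\<close> stands for \<open>b\<close> and
  \<open>(b, False)\<close> for its inverse, and no non-empty reduced word evaluates to the identity.
\<close>

definition free_basis :: "('g, 'm) monoid_scheme \<Rightarrow> 'g set \<Rightarrow> 'g set \<Rightarrow> bool" where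
  "free_basis P F B \<longleftrightarrow>
     B \<subseteq> carrier P \<and> F = generate P B \<and>
     (\<forall>w. w \<noteq> [] \<longrightarrow> fst ` set w \<subseteq> B \<longrightarrow>
          successively (\<lambda>(a, d) (b, e). a = b \<longrightarrow> d = e) w \<longrightarrow>
          list_mult P (map (\<lambda>(b, e). if e then b else inv\<^bsub>P\<^esub> b) w) \<noteq> \<one>\<^bsub>P\<^esub>)"

text \<open>
  The subgroup \<open>C\<close> is the internal free product of the family of subgroups \<open>K i\<close>, \<open>i \<in> I\<close>: it is
  generated by them, and a non-empty word of non-trivial elements of the \<open>K i\<close> without two
  neighbours from the same factor never evaluates to the identity.  Trivial factors are allowed.
\<close>

definition internal_free_product ::
  "('g, 'm) monoid_scheme \<Rightarrow> 'g set \<Rightarrow> 'i set \<Rightarrow> ('i \<Rightarrow> 'g set) \<Rightarrow> bool"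
where
  "internal_free_product P C I K \<longleftrightarrow>
     (\<forall>i\<in>I. subgroup (K i) P) \<and> C = generate P (\<Union>i\<in>I. K i) \<and>
     (\<forall>w. w \<noteq> [] \<longrightarrow> set w \<subseteq> Sigma I (\<lambda>i. K i - {\<one>\<^bsub>P\<^esub>}) \<longrightarrow>
          successively (\<lambda>(i, _) (j, _). i \<noteq> j) w \<longrightarrow>
          list_mult P (map snd w) \<noteq> \<one>\<^bsub>P\<^esub>)"

definition double_coset_reps ::
  "('g, 'm) monoid_scheme \<Rightarrow> 'g set \<Rightarrow> 'g set \<Rightarrow> 'g set \<Rightarrow> bool"
where
  "double_coset_reps P C A X \<longleftrightarrow>
     X \<subseteq> carrier P \<and> (\<forall>p\<in>carrier P. \<exists>!x. x \<in> X \<and> p \<in> (C #>\<^bsub>P\<^esub> x) <#>\<^bsub>P\<^esub> A)"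

datatype 'g kurosh_index = Free_Part | Left_Part 'g | Right_Part 'g

fun kurosh_factor ::
  "('g, 'm) monoid_scheme \<Rightarrow> 'g set \<Rightarrow> 'g set \<Rightarrow> 'g set \<Rightarrow> 'g set \<Rightarrow> 'g kurosh_index \<Rightarrow> 'g set"
where
  "kurosh_factor P A B C F Free_Part = F"
| "kurosh_factor P A B C F (Left_Part x) = C \<inter> conj_set P x A"
| "kurosh_factor P A B C F (Right_Part y) = C \<inter> conj_set P y B"

definition kurosh_decomposition ::
  "('a, 'm) monoid_scheme \<Rightarrow> ('b, 'n) monoid_scheme \<Rightarrow> ('a + 'b) list set \<Rightarrow>
   ('a + 'b) list set \<Rightarrow> ('a + 'b) list set \<Rightarrow> ('a + 'b) list set \<Rightarrow> bool"
where
  "kurosh_decomposition G H C F X Y \<longleftrightarrow>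
     double_coset_reps (free_product G H) C (left_embed G ` carrier G) X \<and>
     double_coset_reps (free_product G H) C (right_embed H ` carrier H) Y \<and>
     internal_free_product (free_product G H) C
       (insert Free_Part (Left_Part ` X \<union> Right_Part ` Y))
       (kurosh_factor (free_product G H) (left_embed G ` carrier G) (right_embed H ` carrier H) C F)"

definition ecard :: "'x set \<Rightarrow> enat" where
  "ecard S = (if finite S then enat (card S) else \<infinity>)"

text \<open>
  The sets of representatives in a Kurosh decomposition are part of the data, since it
  holds only for suitable choices of representatives.
  By Kurosh's theorem every subgroup \<open>C\<close> has a decomposition with \<open>F\<close> free, and the resulting
  rank does not depend on the decomposition or on the free basis.  The rank is therefore
  introduced as a relation, which does not presuppose these facts.
\<close>

definition has_kurosh_rank ::
  "('a, 'm) monoid_scheme \<Rightarrow> ('b, 'n) monoid_scheme \<Rightarrow> ('a + 'b) list set \<Rightarrow> enat \<Rightarrow> bool"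
where
  "has_kurosh_rank G H C r \<longleftrightarrow>
     (\<exists>F B X Y. kurosh_decomposition G H C F X Y \<and> free_basis (free_product G H) F B \<and>
        r = ecard B
          + ecard {x \<in> X. C \<inter> conj_set (free_product G H) x (left_embed G ` carrier G)
                            \<noteq> {\<one>\<^bsub>free_product G H\<^esub>}}
          + ecard {y \<in> Y. C \<inter> conj_set (free_product G H) y (right_embed H ` carrier H)
                            \<noteq> {\<one>\<^bsub>free_product G H\<^esub>}})"

definition finite_kurosh_rank ::
  "('a, 'm) monoid_scheme \<Rightarrow> ('b, 'n) monoid_scheme \<Rightarrow> ('a + 'b) list set \<Rightarrow> bool"
where
  "finite_kurosh_rank G H C \<longleftrightarrow> (\<exists>n::nat. has_kurosh_rank G H C (enat n))"

definition factors_span ::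
  "('a, 'm) monoid_scheme \<Rightarrow> ('b, 'n) monoid_scheme \<Rightarrow> 'a set \<Rightarrow> 'b set \<Rightarrow> ('a + 'b) list set"
where
  "factors_span G H G\<^sub>0 H\<^sub>0 = generate (free_product G H) (left_embed G ` G\<^sub>0 \<union> right_embed H ` H\<^sub>0)"

end

theory Submission
  imports Defs
begin

text \<open>
  Take for \<open>\<Omega>\<close> a free basis \<open>B\<close> of the free part of a Kurosh decomposition of \<open>C\<close> together with the
  finitely many representatives of its non-trivial factors, and let \<open>Q = \<langle>G\<^sub>0, H\<^sub>0\<rangle> \<supseteq> \<Omega>\<close>.  Then \<open>C \<inter> Q\<close>
  is generated by \<open>B\<close> and by the intersections of \<open>Q\<close> with the non-trivial factors.  To see this,
  write an element of \<open>C \<inter> Q\<close> as a reduced word in the Kurosh factors.  A letter outside \<open>Q\<close> is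
  \<open>x s x\<inverse>\<close> with \<open>x \<in> Q\<close> and a syllable \<open>s\<close> outside \<open>G\<^sub>0\<close> and \<open>H\<^sub>0\<close>.  Multiplying \<open>s\<close> by elements
  of \<open>Q\<close> never brings it into \<open>G\<^sub>0\<close> or \<open>H\<^sub>0\<close>, so it could only disappear by merging with another such
  syllable.  Merging requires \<open>x\<inverse> q y\<close> to lie in one of \<open>G\<close>, \<open>H\<close>, where \<open>q \<in> C\<close> is the subword between
  two consecutive letters \<open>x s x\<inverse>\<close> and \<open>y t y\<inverse>\<close> outside \<open>Q\<close>.  Then \<open>x\<close> and \<open>y\<close> represent the same
  double coset, hence \<open>x = y\<close> and \<open>q\<close> lies in the factor of \<open>x\<close>, contradicting reducedness.
\<close>

section \<open>The free product is a group\<close>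

locale two_groups = G: group G + H: group H
  for G :: "('a, 'm) monoid_scheme" and H :: "('b, 'n) monoid_scheme"
begin

abbreviation P where "P \<equiv> free_product G H"

abbreviation syllables where
  "syllables \<equiv> (carrier G - {\<one>\<^bsub>G\<^esub>}) <+> (carrier H - {\<one>\<^bsub>H\<^esub>})"

lemma one_P [simp]: "\<one>\<^bsub>P\<^esub> = []"
  by (simp add: free_product_def)

lemma Nil_mult [simp]: "[] \<otimes>\<^bsub>P\<^esub> w = w"
  by (simp add: free_product_def)

lemma Cons_mult: "(s # u) \<otimes>\<^bsub>P\<^esub> w = syllable_cons G H s (u \<otimes>\<^bsub>P\<^esub> w)"
  by (simp add: free_product_def)

lemma Nil_in_carrier [simp]: "[] \<in> carrier P"
  by (simp add: free_product_def)

lemma Cons_in_carrier_iff: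
  "s # w \<in> carrier P \<longleftrightarrow> s \<in> syllables \<and> w \<in> carrier P \<and> (w = [] \<or> isl s \<noteq> isl (hd w))"
  by (auto simp: free_product_def successively_Cons)

lemma syllable_cons_other_side:
  "w = [] \<or> isl s \<noteq> isl (hd w) \<Longrightarrow> syllable_cons G H s w = s # w"
  by (cases "(G, H, s, w)" rule: syllable_cons.cases) auto

lemma syllable_cons_closed:
  assumes "s \<in> syllables" "w \<in> carrier P"
  shows "syllable_cons G H s w \<in> carrier P"
  using assms
  by (cases "(G, H, s, w)" rule: syllable_cons.cases)
     (auto simp: Cons_in_carrier_iff Plus_def)

lemma mult_closed: "u \<in> carrier P \<Longrightarrow> w \<in> carrier P \<Longrightarrow> u \<otimes>\<^bsub>P\<^esub> w \<in> carrier P"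
  by (induction u) (auto simp: Cons_in_carrier_iff Cons_mult syllable_cons_closed)

lemma mult_Nil: "u \<in> carrier P \<Longrightarrow> u \<otimes>\<^bsub>P\<^esub> [] = u"
  by (induction u) (auto simp: Cons_in_carrier_iff Cons_mult syllable_cons_other_side)

lemma left_embed_closed: "g \<in> carrier G \<Longrightarrow> left_embed G g \<in> carrier P"
  by (auto simp: left_embed_def Cons_in_carrier_iff)

lemma right_embed_closed: "h \<in> carrier H \<Longrightarrow> right_embed H h \<in> carrier P"
  by (auto simp: right_embed_def Cons_in_carrier_iff)

text \<open>Associativity has its whole content here: prepending elements of one factor is an action
  of that factor on normal forms. Only a first syllable \<open>Inl k\<close> of \<open>w\<close> can
  interact with \<open>g\<close> and \<open>g'\<close>; the three auxiliary equations settle the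
  cases in which something cancels or is trivial.\<close>

lemma left_embed_mult_mult:
  assumes "g \<in> carrier G" "g' \<in> carrier G" "w \<in> carrier P"
  shows "left_embed G g \<otimes>\<^bsub>P\<^esub> (left_embed G g' \<otimes>\<^bsub>P\<^esub> w) = left_embed G (g \<otimes>\<^bsub>G\<^esub> g') \<otimes>\<^bsub>P\<^esub> w"
proof (cases "\<exists>k v. w = Inl k # v")
  case True
  then obtain k v where w: "w = Inl k # v" by blast
  have k: "k \<in> carrier G" "k \<noteq> \<one>\<^bsub>G\<^esub>" and v: "v = [] \<or> \<not> isl (hd v)"
    using assms(3) by (auto simp: w Cons_in_carrier_iff)
  have v': "syllable_cons G H (Inl x) v = Inl x # v" for x
    using v by (intro syllable_cons_other_side) auto
  have "g \<otimes>\<^bsub>G\<^esub> g' \<otimes>\<^bsub>G\<^esub> k = g" if "g' \<otimes>\<^bsub>G\<^esub> k = \<one>\<^bsub>G\<^esub>"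
    using that assms k by (simp add: G.m_assoc)
  moreover have "k = g' \<otimes>\<^bsub>G\<^esub> k" if "g' = \<one>\<^bsub>G\<^esub>"
    using that k by simp
  moreover have "g \<otimes>\<^bsub>G\<^esub> (g' \<otimes>\<^bsub>G\<^esub> k) = k" if "g \<otimes>\<^bsub>G\<^esub> g' = \<one>\<^bsub>G\<^esub>"
    using that assms k by (simp flip: G.m_assoc)
  ultimately show ?thesis
    using assms k by (auto simp: w left_embed_def Cons_mult v' G.m_assoc)
next
  case False
  then have "w = [] \<or> \<not> isl (hd w)"
    by (cases w) (auto simp: isl_def)
  then have "syllable_cons G H (Inl x) w = Inl x # w" for x
    by (intro syllable_cons_other_side) auto
  then show ?thesis
    using assms by (auto simp: left_embed_def Cons_mult)
qed

lemma right_embed_mult_mult: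
  assumes "h \<in> carrier H" "h' \<in> carrier H" "w \<in> carrier P"
  shows "right_embed H h \<otimes>\<^bsub>P\<^esub> (right_embed H h' \<otimes>\<^bsub>P\<^esub> w) = right_embed H (h \<otimes>\<^bsub>H\<^esub> h') \<otimes>\<^bsub>P\<^esub> w"
proof (cases "\<exists>k v. w = Inr k # v")
  case True
  then obtain k v where w: "w = Inr k # v" by blast
  have k: "k \<in> carrier H" "k \<noteq> \<one>\<^bsub>H\<^esub>" and v: "v = [] \<or> isl (hd v)"
    using assms(3) by (auto simp: w Cons_in_carrier_iff)
  have v': "syllable_cons G H (Inr x) v = Inr x # v" for x
    using v by (intro syllable_cons_other_side) auto
  have "h \<otimes>\<^bsub>H\<^esub> h' \<otimes>\<^bsub>H\<^esub> k = h" if "h' \<otimes>\<^bsub>H\<^esub> k = \<one>\<^bsub>H\<^esub>"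
    using that assms k by (simp add: H.m_assoc)
  moreover have "k = h' \<otimes>\<^bsub>H\<^esub> k" if "h' = \<one>\<^bsub>H\<^esub>"
    using that k by simp
  moreover have "h \<otimes>\<^bsub>H\<^esub> (h' \<otimes>\<^bsub>H\<^esub> k) = k" if "h \<otimes>\<^bsub>H\<^esub> h' = \<one>\<^bsub>H\<^esub>"
    using that assms k by (simp flip: H.m_assoc)
  ultimately show ?thesis
    using assms k by (auto simp: w right_embed_def Cons_mult v' H.m_assoc)
next
  case False
  then have "w = [] \<or> isl (hd w)"
    by (cases w) (auto simp: isl_def, metis sum.exhaust)
  then have "syllable_cons G H (Inr x) w = Inr x # w" for x
    by (intro syllable_cons_other_side) auto
  then show ?thesis
    using assms by (auto simp: right_embed_def Cons_mult)
qed

text \<open>If \<open>s\<close> and the first syllable \<open>t\<close> of \<open>u = t # v\<close>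
  lie in the same factor, both sides come from letting \<open>s\<close> and \<open>t\<close> act on
  the product of \<open>v\<close> and \<open>w\<close>, once through their product and once in
  succession. The action property of that factor identifies the two.\<close>

lemma syllable_cons_mult:
  assumes "s \<in> syllables" "u \<in> carrier P" "w \<in> carrier P"
  shows "syllable_cons G H s u \<otimes>\<^bsub>P\<^esub> w = syllable_cons G H s (u \<otimes>\<^bsub>P\<^esub> w)"
proof (cases "u = [] \<or> isl s \<noteq> isl (hd u)")
  case True
  then show ?thesis by (simp add: syllable_cons_other_side Cons_mult)
next
  case False
  then obtain t v where u: "u = t # v" "isl s = isl t" by (cases u) auto
  then have v: "v \<otimes>\<^bsub>P\<^esub> w \<in> carrier P"
    using assms by (auto simp: Cons_in_carrier_iff intro: mult_closed)
  show ?thesis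
  proof (cases t)
    case (Inl g')
    with u obtain g where "s = Inl g" by (auto simp: isl_def)
    then show ?thesis
      using left_embed_mult_mult[of g g', OF _ _ v] assms(1,2)
      by (auto simp: u Inl Cons_in_carrier_iff left_embed_def Cons_mult split: if_splits)
  next
    case (Inr h')
    with u obtain h where "s = Inr h" by (cases s) auto
    then show ?thesis
      using right_embed_mult_mult[of h h', OF _ _ v] assms(1,2)
      by (auto simp: u Inr Cons_in_carrier_iff right_embed_def Cons_mult split: if_splits)
  qed
qed

lemma mult_assoc:
  assumes "u \<in> carrier P" "v \<in> carrier P" "w \<in> carrier P"
  shows "u \<otimes>\<^bsub>P\<^esub> v \<otimes>\<^bsub>P\<^esub> w = u \<otimes>\<^bsub>P\<^esub> (v \<otimes>\<^bsub>P\<^esub> w)"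
  using assms
  by (induction u) (auto simp: Cons_in_carrier_iff Cons_mult syllable_cons_mult mult_closed)

lemma left_inverse:
  assumes "w \<in> carrier P"
  shows "\<exists>w'\<in>carrier P. w' \<otimes>\<^bsub>P\<^esub> w = []"
  using assms
proof (induction w)
  case Nil
  show ?case by (rule bexI[of _ "[]"]) auto
next
  case (Cons s v)
  then have s: "s \<in> syllables" and v: "v \<in> carrier P" by (auto simp: Cons_in_carrier_iff)
  from Cons.IH[OF v] obtain v' where v': "v' \<in> carrier P" "v' \<otimes>\<^bsub>P\<^esub> v = []" by blast
  obtain t where t: "[t] \<in> carrier P" "[t] \<otimes>\<^bsub>P\<^esub> (s # v) = v"
  proof (cases s)
    case (Inl g)
    then show ?thesis
      using s by (intro that[of "Inl (inv\<^bsub>G\<^esub> g)"]) (auto simp: Cons_in_carrier_iff Cons_mult)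
  next
    case (Inr h)
    then show ?thesis
      using s by (intro that[of "Inr (inv\<^bsub>H\<^esub> h)"]) (auto simp: Cons_in_carrier_iff Cons_mult)
  qed
  have "v' \<otimes>\<^bsub>P\<^esub> [t] \<otimes>\<^bsub>P\<^esub> (s # v) = []"
    using v' t Cons.prems by (simp add: mult_assoc)
  then show ?case using v' t by (blast intro: mult_closed)
qed

lemma group_free_product: "group P"
  by (rule groupI) (auto simp: mult_closed mult_assoc left_inverse)

sublocale P: group P
  by (rule group_free_product)

section \<open>The embeddings of the two factors\<close>

lemma left_embed_mult:
  "g \<in> carrier G \<Longrightarrow> g' \<in> carrier G \<Longrightarrow>
     left_embed G (g \<otimes>\<^bsub>G\<^esub> g') = left_embed G g \<otimes>\<^bsub>P\<^esub> left_embed G g'"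
  using left_embed_mult_mult[of g g' "[]"] by (simp add: mult_Nil left_embed_closed)

lemma right_embed_mult:
  "h \<in> carrier H \<Longrightarrow> h' \<in> carrier H \<Longrightarrow>
     right_embed H (h \<otimes>\<^bsub>H\<^esub> h') = right_embed H h \<otimes>\<^bsub>P\<^esub> right_embed H h'"
  using right_embed_mult_mult[of h h' "[]"] by (simp add: mult_Nil right_embed_closed)

lemma group_hom_left_embed: "group_hom G P (left_embed G)"
  by unfold_locales (auto simp: hom_def left_embed_closed left_embed_mult)

lemma group_hom_right_embed: "group_hom H P (right_embed H)"
  by unfold_locales (auto simp: hom_def right_embed_closed right_embed_mult)

text \<open>Syllables alternate between the factors, so a normal form with all syllables on one side
  has length at most one.\<close>

lemma one_sided_in_left_embed:
  assumes "p \<in> carrier P" "\<forall>a\<in>set p. isl a"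
  shows "p \<in> left_embed G ` carrier G"
proof (cases p)
  case Nil
  then show ?thesis by (auto simp: left_embed_def image_iff intro!: bexI[of _ "\<one>\<^bsub>G\<^esub>"])
next
  case (Cons a v)
  then have "v = []" using assms by (cases v) (auto simp: Cons_in_carrier_iff)
  then show ?thesis
    using Cons assms by (auto simp: Cons_in_carrier_iff left_embed_def image_iff)
qed

lemma one_sided_in_right_embed:
  assumes "p \<in> carrier P" "\<forall>a\<in>set p. \<not> isl a"
  shows "p \<in> right_embed H ` carrier H"
proof (cases p)
  case Nil
  then show ?thesis by (auto simp: right_embed_def image_iff intro!: bexI[of _ "\<one>\<^bsub>H\<^esub>"])
next
  case (Cons a v)
  then have "v = []" using assms by (cases v) (auto simp: Cons_in_carrier_iff)
  then show ?thesis
    using Cons assms by (auto simp: Cons_in_carrier_iff right_embed_def image_iff)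
qed

end

section \<open>The subgroup generated by subgroups of the factors\<close>

locale two_subgroups = two_groups G H
  for G :: "('a, 'm) monoid_scheme" and H :: "('b, 'n) monoid_scheme" +
  fixes G\<^sub>0 :: "'a set" and H\<^sub>0 :: "'b set"
  assumes G0: "subgroup G\<^sub>0 G" and H0: "subgroup H\<^sub>0 H"
begin

sublocale Q: two_groups "G\<lparr>carrier := G\<^sub>0\<rparr>" "H\<lparr>carrier := H\<^sub>0\<rparr>"
  by (intro two_groups.intro G.subgroup_imp_group H.subgroup_imp_group G0 H0)

lemma syllable_cons_restrict:
  "syllable_cons (G\<lparr>carrier := G\<^sub>0\<rparr>) (H\<lparr>carrier := H\<^sub>0\<rparr>) = syllable_cons G H"
proof (intro ext)
  fix s w
  show "syllable_cons (G\<lparr>carrier := G\<^sub>0\<rparr>) (H\<lparr>carrier := H\<^sub>0\<rparr>) s w = syllable_cons G H s w"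
    by (cases "(G, H, s, w)" rule: syllable_cons.cases) auto
qed

text \<open>Changing the carriers of the factors leaves multiplication and unit alone, so the free
  product of the subgroups is a set of normal forms inside \<open>P\<close>. Its group laws make
  this set a subgroup in \<open>factors_span_eq\<close>.\<close>

lemma free_product_restrict:
  "free_product (G\<lparr>carrier := G\<^sub>0\<rparr>) (H\<lparr>carrier := H\<^sub>0\<rparr>) =
     P\<lparr>carrier := {w \<in> carrier P. set w \<subseteq> G\<^sub>0 <+> H\<^sub>0}\<rparr>"
  using subgroup.subset[OF G0] subgroup.subset[OF H0]
  by (auto simp: free_product_def syllable_cons_restrict)

text \<open>Membership in the span can be read off the syllables. The right side is a subgroup
  containing the generators; conversely, a normal form is the product of its syllables, peeled off
  one at a time.\<close>

lemma factors_span_eq: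
  "factors_span G H G\<^sub>0 H\<^sub>0 = {w \<in> carrier P. set w \<subseteq> G\<^sub>0 <+> H\<^sub>0}" (is "_ = ?Q")
proof
  have "subgroup ?Q P"
    using Q.group_free_product unfolding free_product_restrict
    by (rule P.group_incl_imp_subgroup[rotated]) auto
  then show "factors_span G H G\<^sub>0 H\<^sub>0 \<subseteq> ?Q"
    unfolding factors_span_def using subgroup.subset[OF G0] subgroup.subset[OF H0]
    by (intro P.generate_subgroup_incl)
       (auto simp: left_embed_def right_embed_def Cons_in_carrier_iff)
  show "?Q \<subseteq> factors_span G H G\<^sub>0 H\<^sub>0"
  proof
    fix w assume "w \<in> ?Q"
    then show "w \<in> factors_span G H G\<^sub>0 H\<^sub>0"
    proof (induction w)
      case Nil
      then show ?case using generate.one[of P] by (simp add: factors_span_def)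
    next
      case (Cons s v)
      then have s: "s \<in> syllables" "s \<in> G\<^sub>0 <+> H\<^sub>0" and v: "v \<in> factors_span G H G\<^sub>0 H\<^sub>0"
        and sv: "syllable_cons G H s v = s # v"
        by (auto simp: Cons_in_carrier_iff syllable_cons_other_side)
      have "[s] \<in> factors_span G H G\<^sub>0 H\<^sub>0"
        unfolding factors_span_def using s
        by (intro generate.incl)
           (auto simp: left_embed_def right_embed_def image_iff split: if_splits)
      from generate.eng[OF this[unfolded factors_span_def] v[unfolded factors_span_def]]
      show ?case by (simp add: factors_span_def Cons_mult sv)
    qed
  qed
qed

lemma subgroup_factors_span: "subgroup (factors_span G H G\<^sub>0 H\<^sub>0) P"
  unfolding factors_span_def using subgroup.subset[OF G0] subgroup.subset[OF H0]
  by (intro P.generate_is_subgroup) (auto intro: left_embed_closed right_embed_closed)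

lemma left_embed_in_factors_span_iff:
  "g \<in> carrier G \<Longrightarrow> left_embed G g \<in> factors_span G H G\<^sub>0 H\<^sub>0 \<longleftrightarrow> g \<in> G\<^sub>0"
  using subgroup.one_closed[OF G0]
  by (auto simp: factors_span_eq left_embed_closed) (auto simp: left_embed_def split: if_splits)

lemma right_embed_in_factors_span_iff:
  "h \<in> carrier H \<Longrightarrow> right_embed H h \<in> factors_span G H G\<^sub>0 H\<^sub>0 \<longleftrightarrow> h \<in> H\<^sub>0"
  using subgroup.one_closed[OF H0]
  by (auto simp: factors_span_eq right_embed_closed) (auto simp: right_embed_def split: if_splits)

section \<open>Merging of syllables inside and outside the subgroups\<close>

text \<open>A product of two elements of which exactly one lies in a subgroup lies outside that
  subgroup. In particular it is not the identity, so the two syllables merge and do not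
  cancel.\<close>

lemma syllable_cons_merge:
  assumes "s \<in> syllables" "t \<in> syllables" "isl s = isl t"
    and "(s \<in> G\<^sub>0 <+> H\<^sub>0) \<noteq> (t \<in> G\<^sub>0 <+> H\<^sub>0)"
  obtains r where "syllable_cons G H s (t # v) = r # v" "r \<notin> G\<^sub>0 <+> H\<^sub>0" "isl r = isl s"
proof (cases s)
  case (Inl g)
  with assms obtain g' where t: "t = Inl g'" by (cases t) auto
  have "g \<otimes>\<^bsub>G\<^esub> g' \<notin> G\<^sub>0"
    using assms subgroup.m_closed[OF G0] subgroup.m_inv_closed[OF G0]
    by (auto simp: Inl t) (metis G.inv_solve_left G.inv_solve_right subgroup.mem_carrier[OF G0])+
  then show ?thesis
    using subgroup.one_closed[OF G0] by (intro that[of "Inl (g \<otimes>\<^bsub>G\<^esub> g')"]) (auto simp: Inl t)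
next
  case (Inr h)
  with assms obtain h' where t: "t = Inr h'" by (cases t) auto
  have "h \<otimes>\<^bsub>H\<^esub> h' \<notin> H\<^sub>0"
    using assms subgroup.m_closed[OF H0] subgroup.m_inv_closed[OF H0]
    by (auto simp: Inr t) (metis H.inv_solve_left H.inv_solve_right subgroup.mem_carrier[OF H0])+
  then show ?thesis
    using subgroup.one_closed[OF H0] by (intro that[of "Inr (h \<otimes>\<^bsub>H\<^esub> h')"]) (auto simp: Inr t)
qed

text \<open>The condition on \<open>e\<close> excludes exactly a first syllable from the factor of
  \<open>s\<close> that is outside the subgroup as well, the one situation in which the product
  could fall back into the subgroup.\<close>

lemma bad_syllable_mult:
  assumes "s \<in> syllables" "s \<notin> G\<^sub>0 <+> H\<^sub>0" "e \<in> carrier P"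
    and "e = [] \<or> hd e \<in> G\<^sub>0 <+> H\<^sub>0 \<or> isl (hd e) \<noteq> isl s"
  obtains r v where "[s] \<otimes>\<^bsub>P\<^esub> e = r # v" "r \<notin> G\<^sub>0 <+> H\<^sub>0" "isl r = isl s"
proof (cases "e = [] \<or> isl (hd e) \<noteq> isl s")
  case True
  then have "[s] \<otimes>\<^bsub>P\<^esub> e = s # e" by (auto simp: Cons_mult syllable_cons_other_side)
  then show ?thesis using assms that by blast
next
  case False
  then obtain a v where e: "e = a # v" "isl s = isl a" "a \<in> G\<^sub>0 <+> H\<^sub>0"
    using assms(4) by (cases e) auto
  then have "a \<in> syllables" using assms(3) by (simp add: Cons_in_carrier_iff)
  then obtain r where "syllable_cons G H s (a # v) = r # v" "r \<notin> G\<^sub>0 <+> H\<^sub>0" "isl r = isl s"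
    using syllable_cons_merge[OF assms(1) _ e(2), of v] e(3) assms(2) by blast
  then show ?thesis by (intro that[of r v]) (simp_all add: e(1) Cons_mult)
qed

text \<open>Only the last syllable of \<open>p\<close> can touch \<open>t\<close>, and it merges
  with \<open>t\<close> into a syllable that is again outside. This changes the front of the product
  only if \<open>p\<close> has at most one syllable and lies on the side of \<open>t\<close>;
  otherwise the first syllable of \<open>p\<close> stays in front.\<close>

lemma mult_bad_syllable:
  assumes "p \<in> factors_span G H G\<^sub>0 H\<^sub>0" "t # v \<in> carrier P" "t \<notin> G\<^sub>0 <+> H\<^sub>0"
  shows "\<exists>r u. p \<otimes>\<^bsub>P\<^esub> (t # v) = r # u \<and>
    (if \<forall>a\<in>set p. isl a = isl t then r \<notin> G\<^sub>0 <+> H\<^sub>0 \<and> isl r = isl t else r = hd p)"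
  using assms(1)
proof (induction p)
  case Nil
  then show ?case using assms by simp
next
  case (Cons a p)
  then have p: "p \<in> factors_span G H G\<^sub>0 H\<^sub>0" and a: "a \<in> syllables" "a \<in> G\<^sub>0 <+> H\<^sub>0"
    and ap: "p = [] \<or> isl a \<noteq> isl (hd p)"
    by (auto simp: factors_span_eq Cons_in_carrier_iff)
  have t: "t \<in> syllables" using assms by (simp add: Cons_in_carrier_iff)
  from Cons.IH[OF p] obtain r u where r: "p \<otimes>\<^bsub>P\<^esub> (t # v) = r # u"
    "if \<forall>a\<in>set p. isl a = isl t then r \<notin> G\<^sub>0 <+> H\<^sub>0 \<and> isl r = isl t else r = hd p"
    by blast
  show ?case
  proof (cases "p = [] \<and> isl a = isl t")
    case True
    then obtain r' where "syllable_cons G H a (t # v) = r' # v" "r' \<notin> G\<^sub>0 <+> H\<^sub>0" "isl r' = isl a"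
      using syllable_cons_merge[OF a(1) t, of v] a(2) assms(3) by blast
    with True show ?thesis by (simp add: Cons_mult)
  next
    case False
    \<comment> \<open>Either \<open>p\<close> is empty and \<open>a\<close> lies on the other side
      than \<open>t\<close>, or \<open>r\<close> lies on the side of the first syllable of
      \<open>p\<close>. In both cases \<open>a\<close> is prepended without merging.\<close>
    have ar: "isl a \<noteq> isl r \<and> \<not> (\<forall>b\<in>set (a # p). isl b = isl t)"
    proof (cases p)
      case Nil
      with False r(2) show ?thesis by simp
    next
      case (Cons b p')
      with ap r(2) show ?thesis by (simp split: if_splits)
    qed
    then have "syllable_cons G H a (r # u) = a # r # u"
      by (intro syllable_cons_other_side) simp
    then have "(a # p) \<otimes>\<^bsub>P\<^esub> (t # v) = a # r # u" by (simp add: Cons_mult r(1))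
    with ar show ?thesis by auto
  qed
qed

text \<open>The only danger is that \<open>s\<close>, \<open>p\<close> and \<open>t\<close> all lie
  in one factor, where two outside elements may multiply into the subgroup. Otherwise
  \<open>s\<close> meets a syllable of the other factor or the first syllable of \<open>p\<close>,
  which belongs to the subgroups.\<close>

lemma bad_mult_bad:
  assumes s: "s \<in> syllables" "s \<notin> G\<^sub>0 <+> H\<^sub>0"
    and p: "p \<in> factors_span G H G\<^sub>0 H\<^sub>0"
    and tv: "t # v \<in> carrier P" "t \<notin> G\<^sub>0 <+> H\<^sub>0"
    and no_merge: "\<not> (isl s = isl t \<and> (\<forall>a\<in>set p. isl a = isl t))"
  obtains r u where "[s] \<otimes>\<^bsub>P\<^esub> (p \<otimes>\<^bsub>P\<^esub> (t # v)) = r # u" "r \<notin> G\<^sub>0 <+> H\<^sub>0" "isl r = isl s"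
proof -
  have pP: "p \<in> carrier P" and pQ: "set p \<subseteq> G\<^sub>0 <+> H\<^sub>0" using p by (auto simp: factors_span_eq)
  obtain r u where r: "p \<otimes>\<^bsub>P\<^esub> (t # v) = r # u"
    "if \<forall>a\<in>set p. isl a = isl t then r \<notin> G\<^sub>0 <+> H\<^sub>0 \<and> isl r = isl t else r = hd p"
    using mult_bad_syllable[OF p tv] by blast
  have "r \<in> G\<^sub>0 <+> H\<^sub>0 \<or> isl r \<noteq> isl s"
  proof (cases "\<forall>a\<in>set p. isl a = isl t")
    case True
    with r(2) no_merge show ?thesis by simp
  next
    case False
    then have "hd p \<in> set p" by (cases p) simp_all
    with False r(2) pQ show ?thesis by auto
  qed
  with bad_syllable_mult[OF s mult_closed[OF pP tv(1)]] show ?thesis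
    using that by (simp add: r(1)) blast
qed

end

section \<open>Words in an internal free product\<close>

context group
begin

lemma list_mult_Nil [simp]: "list_mult G [] = \<one>"
  and list_mult_Cons [simp]: "list_mult G (x # xs) = x \<otimes> list_mult G xs"
  by (simp_all add: list_mult_def)

lemma list_mult_in_subgroup: "subgroup S G \<Longrightarrow> set xs \<subseteq> S \<Longrightarrow> list_mult G xs \<in> S"
  by (induction xs) (auto intro: subgroup.one_closed subgroup.m_closed)

lemma list_mult_closed: "set xs \<subseteq> carrier G \<Longrightarrow> list_mult G xs \<in> carrier G"
  by (rule list_mult_in_subgroup[OF subgroup_self])

lemma list_mult_append:
  "set xs \<subseteq> carrier G \<Longrightarrow> set ys \<subseteq> carrier G \<Longrightarrow>
     list_mult G (xs @ ys) = list_mult G xs \<otimes> list_mult G ys"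
  by (induction xs) (auto simp: list_mult_closed m_assoc)

lemma conj_cancel:
  assumes "x \<in> carrier G" "e \<in> carrier G"
  shows "inv x \<otimes> (x \<otimes> e \<otimes> inv x) \<otimes> x = e"
proof -
  have "inv x \<otimes> (x \<otimes> e) = e" using assms by (simp add: m_assoc[symmetric])
  then show ?thesis using assms by (simp add: m_assoc)
qed

text \<open>The equation gives \<open>x' = c\<inverse> x a\<close>, so \<open>x'\<close> lies in the
  double coset of \<open>x\<close> as well as in its own, and a double coset has only one
  representative.\<close>

lemma double_coset_reps_unique:
  assumes "double_coset_reps G C A X" "subgroup C G" "subgroup A G"
    and "x \<in> X" "x' \<in> X" "c \<in> C" "a \<in> A" "c \<otimes> x' = x \<otimes> a"
  shows "x' = x"
proof -
  note C = subgroup.mem_carrier[OF assms(2)] subgroup.one_closed[OF assms(2)]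
  note A = subgroup.mem_carrier[OF assms(3)] subgroup.one_closed[OF assms(3)]
  have x: "x \<in> carrier G" "x' \<in> carrier G"
    using assms by (auto simp: double_coset_reps_def)
  have "x' = \<one> \<otimes> x' \<otimes> \<one>" using x by simp
  then have "x' \<in> (C #> x') <#> A"
    using C A unfolding r_coset_def set_mult_def by blast
  moreover have "x' = inv c \<otimes> x \<otimes> a"
    using assms x C A by (metis inv_closed inv_solve_left m_assoc m_closed)
  then have "x' \<in> (C #> x) <#> A"
    using assms subgroup.m_inv_closed[OF assms(2,6)] unfolding r_coset_def set_mult_def by blast
  ultimately show ?thesis
    using assms x unfolding double_coset_reps_def by blast
qed

end

locale free_factors = group P for P :: "('g, 'm) monoid_scheme" (structure) +
  fixes C :: "'g set" and I :: "'i set" and K :: "'i \<Rightarrow> 'g set"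
  assumes internal: "internal_free_product P C I K"
begin

definition reduced :: "('i \<times> 'g) list \<Rightarrow> bool" where
  "reduced w \<longleftrightarrow> set w \<subseteq> Sigma I (\<lambda>i. K i - {\<one>}) \<and> successively (\<lambda>u v. fst u \<noteq> fst v) w"

abbreviation word_val :: "('i \<times> 'g) list \<Rightarrow> 'g" where
  "word_val w \<equiv> list_mult P (map snd w)"

lemma factor_subgroup: "i \<in> I \<Longrightarrow> subgroup (K i) P"
  using internal by (simp add: internal_free_product_def)

lemma factor_subset: "i \<in> I \<Longrightarrow> K i \<subseteq> C"
  using internal by (auto simp: internal_free_product_def intro: generate.incl)

lemma reduced_val_not_one: "reduced w \<Longrightarrow> w \<noteq> [] \<Longrightarrow> word_val w \<noteq> \<one>"
proof -
  have "(\<lambda>(i :: 'i, _ :: 'g) (j, _ :: 'g). i \<noteq> j) = (\<lambda>u v. fst u \<noteq> fst v)"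
    by (auto simp: fun_eq_iff)
  then show "reduced w \<Longrightarrow> w \<noteq> [] \<Longrightarrow> word_val w \<noteq> \<one>"
    using internal by (simp add: internal_free_product_def reduced_def)
qed

lemma reduced_Cons_iff:
  "reduced ((i, k) # w) \<longleftrightarrow>
     i \<in> I \<and> k \<in> K i \<and> k \<noteq> \<one> \<and> reduced w \<and> (w = [] \<or> i \<noteq> fst (hd w))"
  by (auto simp: reduced_def successively_Cons)

lemma reduced_append_iff:
  "reduced (u @ w) \<longleftrightarrow>
     reduced u \<and> reduced w \<and> (u = [] \<or> w = [] \<or> fst (last u) \<noteq> fst (hd w))"
  by (auto simp: reduced_def successively_append_iff)

lemma reduced_letters_in_carrier: "reduced w \<Longrightarrow> set (map snd w) \<subseteq> carrier P"
  using factor_subgroup subgroup.mem_carrier by (fastforce simp: reduced_def)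

lemma word_val_closed: "reduced w \<Longrightarrow> word_val w \<in> carrier P"
  by (rule list_mult_closed[OF reduced_letters_in_carrier])

lemma reduced_mult_letter:
  assumes "i \<in> I" "k \<in> K i" "reduced w"
  shows "\<exists>w'. reduced w' \<and> word_val w' = k \<otimes> word_val w"
proof -
  note Ki = factor_subgroup[OF assms(1)]
  have k: "k \<in> carrier P" and w: "word_val w \<in> carrier P"
    using subgroup.mem_carrier[OF Ki assms(2)] word_val_closed[OF assms(3)] .
  consider "k = \<one>" | "k \<noteq> \<one>" "w = [] \<or> fst (hd w) \<noteq> i"
    | k' v where "k \<noteq> \<one>" "w = (i, k') # v"
    by (metis list.exhaust_sel prod.collapse)
  then show ?thesis
  proof cases
    case 1
    with assms w show ?thesis by auto
  next
    case 2
    with assms show ?thesis by (intro exI[of _ "(i, k) # w"]) (auto simp: reduced_Cons_iff)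
  next
    case 3
    then have k': "k' \<in> K i" and v: "reduced v" "v = [] \<or> i \<noteq> fst (hd v)"
      using assms(3) by (auto simp: reduced_Cons_iff)
    have "k' \<in> carrier P" "word_val v \<in> carrier P"
      using subgroup.mem_carrier[OF Ki k'] word_val_closed[OF v(1)] .
    then have eq: "k \<otimes> word_val w = (k \<otimes> k') \<otimes> word_val v"
      using k by (simp add: 3 m_assoc)
    show ?thesis
    proof (cases "k \<otimes> k' = \<one>")
      case True
      with eq v \<open>word_val v \<in> carrier P\<close> show ?thesis by auto
    next
      case False
      with eq v assms k' show ?thesis
        by (intro exI[of _ "(i, k \<otimes> k') # v"])
           (auto simp: reduced_Cons_iff intro: subgroup.m_closed[OF Ki])
    qed
  qed
qed

lemma reduced_word_exists:
  assumes "c \<in> C"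
  obtains w where "reduced w" "word_val w = c"
proof -
  have sub: "(\<Union>i\<in>I. K i) \<subseteq> carrier P"
    using subgroup.subset[OF factor_subgroup] by (rule UN_least)
  have c: "c \<in> generate P (\<Union>i\<in>I. K i)"
    using assms internal by (simp add: internal_free_product_def)
  \<comment> \<open>The claim is generalised from the empty word to every reduced \<open>w\<close>,
    so that in the case of a product the two factors can be applied one after the other.\<close>
  have "\<exists>w'. reduced w' \<and> word_val w' = c \<otimes> word_val w" if "reduced w" for w
    using c that
  proof (induction arbitrary: w rule: generate.induct)
    case one
    then show ?case using word_val_closed[of w] by auto
  next
    case (incl h)
    from incl(1) obtain i where "i \<in> I" "h \<in> K i" by (rule UN_E)
    then show ?case by (rule reduced_mult_letter[OF _ _ incl(2)])
  next
    case (inv h)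
    from inv(1) obtain i where i: "i \<in> I" "h \<in> K i" by (rule UN_E)
    then have "inv h \<in> K i" using subgroup.m_inv_closed[OF factor_subgroup] by simp
    with i(1) show ?case by (rule reduced_mult_letter[OF _ _ inv(2)])
  next
    case (eng h1 h2)
    obtain w2 where w2: "reduced w2" "word_val w2 = h2 \<otimes> word_val w"
      using eng.IH(2)[OF eng.prems] by blast
    obtain w1 where w1: "reduced w1" "word_val w1 = h1 \<otimes> word_val w2"
      using eng.IH(1)[OF w2(1)] by blast
    have "h1 \<in> carrier P" "h2 \<in> carrier P" "word_val w \<in> carrier P"
      using generate_in_carrier[OF sub eng.hyps(1)] generate_in_carrier[OF sub eng.hyps(2)]
        word_val_closed[OF eng.prems] .
    with w1 w2 show ?case by (intro exI[of _ w1]) (simp add: m_assoc)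
  qed
  moreover have "reduced []" by (simp add: reduced_def)
  ultimately obtain w where "reduced w" "word_val w = c \<otimes> word_val []" by metis
  with that show ?thesis using generate_in_carrier[OF sub c] by simp
qed

text \<open>Otherwise the inverse of the value could be appended as a further letter of index
  \<open>i\<close>, giving a non-empty reduced word with value one.\<close>

lemma reduced_val_not_in_factor:
  assumes "reduced w" "w \<noteq> []" "i \<in> I" "fst (last w) \<noteq> i"
  shows "word_val w \<notin> K i"
proof
  assume val: "word_val w \<in> K i"
  note Ki = factor_subgroup[OF assms(3)]
  have "word_val w \<noteq> \<one>" by (rule reduced_val_not_one[OF assms(1,2)])
  moreover have v: "word_val w \<in> carrier P" by (rule subgroup.mem_carrier[OF Ki val])
  ultimately have "inv (word_val w) \<noteq> \<one>" by simp
  then have "reduced (w @ [(i, inv (word_val w))])"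
    using assms subgroup.m_inv_closed[OF Ki val]
    by (simp add: reduced_append_iff reduced_Cons_iff) (simp add: reduced_def)
  from reduced_val_not_one[OF this] show False
    using v reduced_letters_in_carrier[OF assms(1)] by (simp add: list_mult_append)
qed

end

section \<open>Kurosh decompositions and subgroups generated by factor subgroups\<close>

text \<open>These preimages become the subgroups of \<open>G\<^sub>0\<close> and
  \<open>H\<^sub>0\<close> that the theorem asks for. A general homomorphism \<open>h\<close> lets
  one proof serve both embeddings.\<close>

lemma (in group_hom) conj_preimage_subgroup:
  assumes "subgroup G\<^sub>0 G" "subgroup C H" "x \<in> carrier H"
  shows "subgroup {g \<in> G\<^sub>0. x \<otimes>\<^bsub>H\<^esub> h g \<otimes>\<^bsub>H\<^esub> inv\<^bsub>H\<^esub> x \<in> C} (G\<lparr>carrier := G\<^sub>0\<rparr>)" (is "subgroup ?S _")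
proof -
  note G0 = subgroup.mem_carrier[OF assms(1)]
  have "subgroup ?S G"
  proof (rule G.subgroupI)
    show "?S \<subseteq> carrier G" using G0 by auto
    have "\<one>\<^bsub>G\<^esub> \<in> ?S"
      using assms subgroup.one_closed[OF assms(1)] subgroup.one_closed[OF assms(2)] by simp
    then show "?S \<noteq> {}" by blast
  next
    fix g assume g: "g \<in> ?S"
    have "inv\<^bsub>H\<^esub> (x \<otimes>\<^bsub>H\<^esub> h g \<otimes>\<^bsub>H\<^esub> inv\<^bsub>H\<^esub> x) = x \<otimes>\<^bsub>H\<^esub> h (inv\<^bsub>G\<^esub> g) \<otimes>\<^bsub>H\<^esub> inv\<^bsub>H\<^esub> x"
      using g G0 assms(3) by (simp add: H.inv_mult_group H.m_assoc)
    with g show "inv\<^bsub>G\<^esub> g \<in> ?S"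
      using subgroup.m_inv_closed[OF assms(1)] subgroup.m_inv_closed[OF assms(2)] by force
  next
    fix g g' assume g: "g \<in> ?S" and g': "g' \<in> ?S"
    have "inv\<^bsub>H\<^esub> x \<otimes>\<^bsub>H\<^esub> (x \<otimes>\<^bsub>H\<^esub> z) = z" if "z \<in> carrier H" for z
      using that assms(3) by (simp flip: H.m_assoc)
    then have "(x \<otimes>\<^bsub>H\<^esub> h g \<otimes>\<^bsub>H\<^esub> inv\<^bsub>H\<^esub> x) \<otimes>\<^bsub>H\<^esub> (x \<otimes>\<^bsub>H\<^esub> h g' \<otimes>\<^bsub>H\<^esub> inv\<^bsub>H\<^esub> x) =
        x \<otimes>\<^bsub>H\<^esub> h (g \<otimes>\<^bsub>G\<^esub> g') \<otimes>\<^bsub>H\<^esub> inv\<^bsub>H\<^esub> x"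
      using g g' G0 assms(3) by (simp add: H.m_assoc)
    with g g' show "g \<otimes>\<^bsub>G\<^esub> g' \<in> ?S"
      using subgroup.m_closed[OF assms(1)] subgroup.m_closed[OF assms(2)] by force
  qed
  then show ?thesis by (rule G.subgroup_incl[OF _ assms(1)]) auto
qed

text \<open>The free part has no representative. Wherever the value matters, the index is known or
  shown to differ from \<open>Free_Part\<close>.\<close>

fun kurosh_rep :: "'g kurosh_index \<Rightarrow> 'g" where
  "kurosh_rep Free_Part = undefined"
| "kurosh_rep (Left_Part x) = x"
| "kurosh_rep (Right_Part y) = y"

text \<open>This is meant for comparison with \<open>isl\<close> on syllables. The free part gets
  \<open>False\<close> by default, so \<open>False\<close> means a right factor only together with
  \<open>i \<noteq> Free_Part\<close>.\<close>

fun is_left :: "'g kurosh_index \<Rightarrow> bool" where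
  "is_left (Left_Part x) \<longleftrightarrow> True"
| "is_left _ \<longleftrightarrow> False"

text \<open>One choice of \<open>G\<^sub>0\<close> and \<open>H\<^sub>0\<close> is fixed. The last
  three assumptions together express that \<Omega> is contained in their span.\<close>

locale kurosh_in_span = two_subgroups G H G\<^sub>0 H\<^sub>0
  for G :: "('a, 'm) monoid_scheme" and H :: "('b, 'n) monoid_scheme" and G\<^sub>0 H\<^sub>0 +
  fixes C F B X Y :: "('a + 'b) list set"
  assumes C: "subgroup C (free_product G H)"
    and decomposition: "kurosh_decomposition G H C F X Y"
    and basis: "free_basis (free_product G H) F B"
    and basis_in_span: "B \<subseteq> factors_span G H G\<^sub>0 H\<^sub>0"
    and left_reps_in_span:
      "{x \<in> X. C \<inter> conj_set (free_product G H) x (left_embed G ` carrier G) \<noteq> {[]}}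
         \<subseteq> factors_span G H G\<^sub>0 H\<^sub>0"
    and right_reps_in_span:
      "{y \<in> Y. C \<inter> conj_set (free_product G H) y (right_embed H ` carrier H) \<noteq> {[]}}
         \<subseteq> factors_span G H G\<^sub>0 H\<^sub>0"
begin

abbreviation Q where "Q \<equiv> factors_span G H G\<^sub>0 H\<^sub>0"
abbreviation GP where "GP \<equiv> left_embed G ` carrier G"
abbreviation HP where "HP \<equiv> right_embed H ` carrier H"
abbreviation indices where "indices \<equiv> insert Free_Part (Left_Part ` X \<union> Right_Part ` Y)"
abbreviation factor where "factor \<equiv> kurosh_factor P GP HP C F"

sublocale KF: free_factors P C indices factor
  using decomposition P.group_axioms
  by (simp add: free_factors_def free_factors_axioms_def kurosh_decomposition_def)

lemma reps_X: "double_coset_reps P C GP X" and reps_Y: "double_coset_reps P C HP Y"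
  using decomposition by (simp_all add: kurosh_decomposition_def)

lemma subgroup_GP: "subgroup GP P" and subgroup_HP: "subgroup HP P"
  by (rule group_hom.img_is_subgroup group_hom_left_embed group_hom_right_embed)+

lemma span_closed:
  "\<And>x. x \<in> Q \<Longrightarrow> x \<in> carrier P"
  "\<And>x y. x \<in> Q \<Longrightarrow> y \<in> Q \<Longrightarrow> x \<otimes>\<^bsub>P\<^esub> y \<in> Q"
  "\<And>x. x \<in> Q \<Longrightarrow> inv\<^bsub>P\<^esub> x \<in> Q"
  by (rule subgroup.mem_carrier[OF subgroup_factors_span]
      subgroup.m_closed[OF subgroup_factors_span]
      subgroup.m_inv_closed[OF subgroup_factors_span], assumption+)+

lemma free_part_eq: "F = generate P B"
  using basis by (simp add: free_basis_def)

lemma free_part_in_span: "F \<subseteq> Q"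
  unfolding free_part_eq by (rule P.generate_subgroup_incl[OF basis_in_span subgroup_factors_span])

lemma kurosh_rep_in_carrier:
  "i \<in> indices \<Longrightarrow> i \<noteq> Free_Part \<Longrightarrow> kurosh_rep i \<in> carrier P"
  using reps_X reps_Y by (auto simp: double_coset_reps_def)

text \<open>The element \<open>k\<close> itself witnesses that its factor is non-trivial, and
  representatives of non-trivial factors lie in \<open>Q\<close> by assumption.\<close>

lemma nonfree_factor_element:
  assumes i: "i \<in> indices" "i \<noteq> Free_Part" and k: "k \<in> factor i" "k \<noteq> []"
  obtains s where "s \<in> syllables" "isl s = is_left i" "kurosh_rep i \<in> Q"
    "k = kurosh_rep i \<otimes>\<^bsub>P\<^esub> [s] \<otimes>\<^bsub>P\<^esub> inv\<^bsub>P\<^esub> (kurosh_rep i)"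
proof -
  have rep: "kurosh_rep i \<in> carrier P" by (rule kurosh_rep_in_carrier[OF i])
  show ?thesis
  proof (cases i)
    case Free_Part
    with i show ?thesis by simp
  next
    case (Left_Part x)
    with k obtain g where g: "g \<in> carrier G" "k = x \<otimes>\<^bsub>P\<^esub> left_embed G g \<otimes>\<^bsub>P\<^esub> inv\<^bsub>P\<^esub> x"
      by (auto simp: conj_set_def)
    then have "g \<noteq> \<one>\<^bsub>G\<^esub>"
      using k rep Left_Part P.r_inv[of x] by (auto simp: left_embed_def mult_Nil)
    moreover have "x \<in> Q"
      using left_reps_in_span i k Left_Part by auto
    ultimately show ?thesis
      using g by (intro that[of "Inl g"]) (auto simp: Left_Part left_embed_def)
  next
    case (Right_Part y)
    with k obtain h where h: "h \<in> carrier H" "k = y \<otimes>\<^bsub>P\<^esub> right_embed H h \<otimes>\<^bsub>P\<^esub> inv\<^bsub>P\<^esub> y"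
      by (auto simp: conj_set_def)
    then have "h \<noteq> \<one>\<^bsub>H\<^esub>"
      using k rep Right_Part P.r_inv[of y] by (auto simp: right_embed_def mult_Nil)
    moreover have "y \<in> Q"
      using right_reps_in_span i k Right_Part by auto
    ultimately show ?thesis
      using h by (intro that[of "Inr h"]) (auto simp: Right_Part right_embed_def)
  qed
qed

text \<open>This lets left and right factors be treated at once: \<open>A\<close> is the embedded
  group \<open>G\<close> or \<open>H\<close>, \<open>Z\<close> its set of representatives, and
  \<open>part\<close> the constructor that recovers an index from its representative.\<close>

lemma nonfree_index_data:
  assumes "i \<in> indices" "j \<in> indices" "i \<noteq> Free_Part" "j \<noteq> Free_Part" "is_left i = is_left j"
  obtains A Z part where "subgroup A P" "double_coset_reps P C A Z"
    "kurosh_rep i \<in> Z" "kurosh_rep j \<in> Z" "i = part (kurosh_rep i)" "j = part (kurosh_rep j)"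
    "factor i = C \<inter> conj_set P (kurosh_rep i) A"
    "\<And>p. p \<in> carrier P \<Longrightarrow> \<forall>a\<in>set p. isl a = is_left i \<Longrightarrow> p \<in> A"
proof (cases "is_left i")
  case True
  with assms obtain x x' where "i = Left_Part x" "j = Left_Part x'" "x \<in> X" "x' \<in> X" by auto
  then show ?thesis
    using subgroup_GP reps_X one_sided_in_left_embed
    by (intro that[of GP X Left_Part]) auto
next
  case False
  with assms obtain y y' where "i = Right_Part y" "j = Right_Part y'" "y \<in> Y" "y' \<in> Y" by auto
  then show ?thesis
    using subgroup_HP reps_Y one_sided_in_right_embed
    by (intro that[of HP Y Right_Part]) auto
qed

section \<open>Letters outside the span\<close>

text \<open>A one-sided link \<open>p\<close> lies in the embedded factor \<open>A\<close>, so
  \<open>q y = x p\<close> with \<open>q\<close> in \<open>C\<close> puts \<open>x\<close> and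
  \<open>y\<close> into one double coset. The two indices then agree, and \<open>q\<close> would be
  an element of their common factor.\<close>

lemma no_one_sided_link:
  assumes red: "KF.reduced ((i, k) # q @ (j, k') # r)"
    and nonfree: "i \<noteq> Free_Part" "j \<noteq> Free_Part" and side: "is_left i = is_left j"
    and one_sided: "\<forall>a\<in>set (inv\<^bsub>P\<^esub> (kurosh_rep i) \<otimes>\<^bsub>P\<^esub> KF.word_val q \<otimes>\<^bsub>P\<^esub> kurosh_rep j). isl a = is_left i"
  shows False
proof -
  let ?x = "kurosh_rep i" and ?y = "kurosh_rep j" and ?q = "KF.word_val q"
  have ij: "i \<in> indices" "j \<in> indices" and q: "KF.reduced q"
    and link: "q = [] \<Longrightarrow> i \<noteq> j" "q \<noteq> [] \<Longrightarrow> fst (last q) \<noteq> j"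
    using red by (simp_all add: KF.reduced_Cons_iff KF.reduced_append_iff split: if_splits)
  have x: "?x \<in> carrier P" and y: "?y \<in> carrier P" and qP: "?q \<in> carrier P"
    using kurosh_rep_in_carrier[OF ij(1) nonfree(1)] kurosh_rep_in_carrier[OF ij(2) nonfree(2)]
      KF.word_val_closed[OF q] .
  have qC: "?q \<in> C"
    using q KF.factor_subset by (intro P.list_mult_in_subgroup[OF C]) (fastforce simp: KF.reduced_def)
  obtain A Z part where A: "subgroup A P" "double_coset_reps P C A Z" "?x \<in> Z" "?y \<in> Z"
    "i = part ?x" "j = part ?y" "factor i = C \<inter> conj_set P ?x A"
    "\<And>p. p \<in> carrier P \<Longrightarrow> \<forall>a\<in>set p. isl a = is_left i \<Longrightarrow> p \<in> A"
    using nonfree_index_data[OF ij nonfree side] by metis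
  define p where "p = inv\<^bsub>P\<^esub> ?x \<otimes>\<^bsub>P\<^esub> ?q \<otimes>\<^bsub>P\<^esub> ?y"
  have pP: "p \<in> carrier P" using x y qP by (simp add: p_def)
  have pA: "p \<in> A"
    using A(8)[OF pP] one_sided by (simp add: p_def)
  have xp: "?q \<otimes>\<^bsub>P\<^esub> ?y = ?x \<otimes>\<^bsub>P\<^esub> p"
    using x y qP by (simp add: p_def P.m_assoc[symmetric])
  then have "?y = ?x"
    by (rule P.double_coset_reps_unique[OF A(2) C A(1,3,4) qC pA])
  then have eq: "i = j" using A(5,6) by simp
  \<comment> \<open>With \<open>q\<close> empty the two letters would be neighbours, and neighbours
    in a reduced word have different indices.\<close>
  then have "q \<noteq> []" using link by auto
  have "?q = ?x \<otimes>\<^bsub>P\<^esub> p \<otimes>\<^bsub>P\<^esub> inv\<^bsub>P\<^esub> ?x"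
    using xp x qP \<open>?y = ?x\<close> by (metis P.inv_solve_right P.m_closed pP)
  then have "?q \<in> factor i"
    using A(7) qC pA by (auto simp: conj_set_def)
  moreover have "fst (last q) \<noteq> i" using link(2) \<open>q \<noteq> []\<close> eq by simp
  ultimately show False
    using KF.reduced_val_not_in_factor[OF q \<open>q \<noteq> []\<close> ij(1)] by blast
qed

text \<open>Two letters outside \<open>Q\<close> never merge, so the first of them stays visible in the normal form.\<close>

lemma bad_word:
  assumes "KF.reduced ((i, k) # r)" "k \<notin> Q"
  shows "\<exists>s v. inv\<^bsub>P\<^esub> (kurosh_rep i) \<otimes>\<^bsub>P\<^esub> KF.word_val ((i, k) # r) = s # v \<and>
    s \<notin> G\<^sub>0 <+> H\<^sub>0 \<and> isl s = is_left i \<and> kurosh_rep i \<in> Q \<and> i \<noteq> Free_Part"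
  using assms
proof (induction r arbitrary: i k rule: measure_induct_rule[where f = length])
  case (less r)
  let ?x = "kurosh_rep i" and ?R = "KF.word_val r"
  have i: "i \<in> indices" and k: "k \<in> factor i" "k \<noteq> []" and r: "KF.reduced r"
    using less.prems(1) by (simp_all add: KF.reduced_Cons_iff)
  have nf: "i \<noteq> Free_Part" using k(1) less.prems(2) free_part_in_span by auto
  obtain s where s: "s \<in> syllables" "isl s = is_left i" and xQ: "?x \<in> Q"
    and k_eq: "k = ?x \<otimes>\<^bsub>P\<^esub> [s] \<otimes>\<^bsub>P\<^esub> inv\<^bsub>P\<^esub> ?x"
    by (rule nonfree_factor_element[OF i nf k])
  note x = span_closed(1)[OF xQ] and xiQ = span_closed(3)[OF xQ]
  have sP: "[s] \<in> carrier P" using s by (simp add: Cons_in_carrier_iff)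
  have s0: "s \<notin> G\<^sub>0 <+> H\<^sub>0"
  proof
    assume "s \<in> G\<^sub>0 <+> H\<^sub>0"
    then have "[s] \<in> Q" using sP by (simp add: factors_span_eq)
    then have "k \<in> Q" unfolding k_eq by (intro span_closed xQ)
    with less.prems(2) show False by simp
  qed
  have R: "?R \<in> carrier P" by (rule KF.word_val_closed[OF r])
  have cancel: "inv\<^bsub>P\<^esub> z \<otimes>\<^bsub>P\<^esub> (z \<otimes>\<^bsub>P\<^esub> w) = w" "z \<otimes>\<^bsub>P\<^esub> (inv\<^bsub>P\<^esub> z \<otimes>\<^bsub>P\<^esub> w) = w"
    if "z \<in> carrier P" "w \<in> carrier P" for z w
    using that by (simp_all add: P.m_assoc[symmetric])
  \<comment> \<open>The left half of the conjugation cancels. What remains is \<open>s\<close> in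
    front of a product of which only the first syllable matters.\<close>
  have val: "inv\<^bsub>P\<^esub> ?x \<otimes>\<^bsub>P\<^esub> KF.word_val ((i, k) # r) = [s] \<otimes>\<^bsub>P\<^esub> (inv\<^bsub>P\<^esub> ?x \<otimes>\<^bsub>P\<^esub> ?R)"
    using x R sP by (simp add: k_eq P.m_assoc cancel)
  show ?case
  proof (cases "\<exists>a\<in>set r. snd a \<notin> Q")
    case False
    \<comment> \<open>All later letters lie in \<open>Q\<close>, and so does everything to the right
      of \<open>s\<close>; multiplying by it cannot bring \<open>s\<close> into the
      subgroups.\<close>
    then have "?R \<in> Q" by (intro P.list_mult_in_subgroup[OF subgroup_factors_span]) auto
    then have eQ: "inv\<^bsub>P\<^esub> ?x \<otimes>\<^bsub>P\<^esub> ?R \<in> Q" by (intro span_closed xQ)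
    then have "set (inv\<^bsub>P\<^esub> ?x \<otimes>\<^bsub>P\<^esub> ?R) \<subseteq> G\<^sub>0 <+> H\<^sub>0" by (simp add: factors_span_eq)
    then have hd: "inv\<^bsub>P\<^esub> ?x \<otimes>\<^bsub>P\<^esub> ?R = [] \<or> hd (inv\<^bsub>P\<^esub> ?x \<otimes>\<^bsub>P\<^esub> ?R) \<in> G\<^sub>0 <+> H\<^sub>0 \<or>
        isl (hd (inv\<^bsub>P\<^esub> ?x \<otimes>\<^bsub>P\<^esub> ?R)) \<noteq> isl s"
      by (cases "inv\<^bsub>P\<^esub> ?x \<otimes>\<^bsub>P\<^esub> ?R") simp_all
    obtain t v where "[s] \<otimes>\<^bsub>P\<^esub> (inv\<^bsub>P\<^esub> ?x \<otimes>\<^bsub>P\<^esub> ?R) = t # v" "t \<notin> G\<^sub>0 <+> H\<^sub>0" "isl t = isl s"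
      by (rule bad_syllable_mult[OF s(1) s0 span_closed(1)[OF eQ] hd])
    with val s(2) xQ nf show ?thesis by simp
  next
    case True
    \<comment> \<open>The word is cut at the next letter outside \<open>Q\<close>. The induction is
      on length because it resumes at \<open>b\<close> and skips all of \<open>q\<close>.\<close>
    from split_list_first_prop[OF this] obtain q b r'
      where r_eq: "r = q @ b # r'" and "snd b \<notin> Q" and qQ: "\<forall>a\<in>set q. snd a \<in> Q"
      by blast
    then obtain j k' where b: "b = (j, k')" and k': "k' \<notin> Q" by (cases b) auto
    let ?y = "kurosh_rep j" and ?W = "KF.word_val ((j, k') # r')"
    have red: "KF.reduced ((j, k') # r')" and q: "KF.reduced q"
      using r by (simp_all add: r_eq b KF.reduced_append_iff)
    from less.IH[OF _ red k'] obtain t v where t: "inv\<^bsub>P\<^esub> ?y \<otimes>\<^bsub>P\<^esub> ?W = t # v" "t \<notin> G\<^sub>0 <+> H\<^sub>0"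
      "isl t = is_left j" and yQ: "?y \<in> Q" and nfj: "j \<noteq> Free_Part"
      by (auto simp: r_eq)
    note y = span_closed(1)[OF yQ]
    have W: "?W \<in> carrier P" by (rule KF.word_val_closed[OF red])
    have tv: "t # v \<in> carrier P" using y W unfolding t(1)[symmetric] by blast
    \<comment> \<open>This is the link between the visible outside syllables \<open>s\<close> and
      \<open>t\<close>: what is left of the two conjugators and of the word between them.\<close>
    define p where "p = inv\<^bsub>P\<^esub> ?x \<otimes>\<^bsub>P\<^esub> KF.word_val q \<otimes>\<^bsub>P\<^esub> ?y"
    have "KF.word_val q \<in> Q"
      using qQ by (intro P.list_mult_in_subgroup[OF subgroup_factors_span]) auto
    then have pQ: "p \<in> Q" unfolding p_def by (intro span_closed xQ yQ)
    have "?R = KF.word_val q \<otimes>\<^bsub>P\<^esub> ?W"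
      using P.list_mult_append[OF KF.reduced_letters_in_carrier[OF q] KF.reduced_letters_in_carrier[OF red]]
      by (simp add: r_eq b)
    also have "\<dots> = KF.word_val q \<otimes>\<^bsub>P\<^esub> (?y \<otimes>\<^bsub>P\<^esub> (t # v))"
      using y W unfolding t(1)[symmetric] by (simp only: cancel)
    finally have "inv\<^bsub>P\<^esub> ?x \<otimes>\<^bsub>P\<^esub> ?R = p \<otimes>\<^bsub>P\<^esub> (t # v)"
      using x y tv KF.word_val_closed[OF q] by (simp only: p_def P.m_assoc P.inv_closed P.m_closed)
    moreover have "\<not> (isl s = isl t \<and> (\<forall>a\<in>set p. isl a = isl t))"
      using no_one_sided_link[of i k q j k' r'] less.prems(1) nf nfj s(2) t(3)
      by (auto simp: p_def r_eq b)
    then obtain z u where "[s] \<otimes>\<^bsub>P\<^esub> (p \<otimes>\<^bsub>P\<^esub> (t # v)) = z # u" "z \<notin> G\<^sub>0 <+> H\<^sub>0" "isl z = isl s"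
      by (rule bad_mult_bad[OF s(1) s0 pQ tv t(2)])
    ultimately show ?thesis using val s(2) xQ nf by simp
  qed
qed

text \<open>The word is cut at its first letter outside \<open>Q\<close>; the suffix from there has
  value in \<open>Q\<close>, since the prefix and the whole word do. By \<open>bad_word\<close> its
  product with an element of \<open>Q\<close> shows a syllable outside the subgroups, which no
  element of \<open>Q\<close> has.\<close>

lemma letters_in_span:
  assumes "KF.reduced w" "KF.word_val w \<in> Q"
  shows "snd ` set w \<subseteq> Q"
proof (rule ccontr)
  assume "\<not> ?thesis"
  then have "\<exists>a\<in>set w. snd a \<notin> Q" by blast
  from split_list_first_prop[OF this] obtain q b r
    where w: "w = q @ b # r" and "snd b \<notin> Q" and qQ: "\<forall>a\<in>set q. snd a \<in> Q"
    by blast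
  then obtain i k where b: "b = (i, k)" and k: "k \<notin> Q" by (cases b) auto
  let ?W = "KF.word_val ((i, k) # r)"
  have red: "KF.reduced ((i, k) # r)" and q: "KF.reduced q"
    using assms(1) by (simp_all add: w b KF.reduced_append_iff)
  from bad_word[OF red k] obtain s v where s: "inv\<^bsub>P\<^esub> (kurosh_rep i) \<otimes>\<^bsub>P\<^esub> ?W = s # v"
    "s \<notin> G\<^sub>0 <+> H\<^sub>0" and xQ: "kurosh_rep i \<in> Q" by blast
  have qv: "KF.word_val q \<in> Q"
    using qQ by (intro P.list_mult_in_subgroup[OF subgroup_factors_span]) auto
  have W: "?W \<in> carrier P" by (rule KF.word_val_closed[OF red])
  have "KF.word_val w = KF.word_val q \<otimes>\<^bsub>P\<^esub> ?W"
    using P.list_mult_append[OF KF.reduced_letters_in_carrier[OF q] KF.reduced_letters_in_carrier[OF red]]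
    by (simp add: w b)
  then have "?W = inv\<^bsub>P\<^esub> (KF.word_val q) \<otimes>\<^bsub>P\<^esub> KF.word_val w"
    using span_closed(1)[OF qv] span_closed(1)[OF assms(2)] W by (metis P.inv_solve_left)
  then have "?W \<in> Q" using span_closed(2)[OF span_closed(3)[OF qv] assms(2)] by simp
  then have "s # v \<in> Q" unfolding s(1)[symmetric] by (intro span_closed xQ)
  then show False using s(2) by (simp add: factors_span_eq)
qed

section \<open>Generators of the intersection\<close>

text \<open>The representative \<open>x\<close> lies in \<open>Q\<close>, so conjugation by it does
  not affect membership in \<open>Q\<close>: the conjugate of an embedded \<open>g\<close> is in
  \<open>Q\<close> exactly if \<open>g\<close> is in \<open>G\<^sub>0\<close>.\<close>

lemma left_letters_in_span:
  assumes "x \<in> {x \<in> X. C \<inter> conj_set P x GP \<noteq> {[]}}"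
  shows "C \<inter> conj_set P x GP \<inter> Q =
    conj_set P x (left_embed G ` {g \<in> G\<^sub>0. x \<otimes>\<^bsub>P\<^esub> left_embed G g \<otimes>\<^bsub>P\<^esub> inv\<^bsub>P\<^esub> x \<in> C})"
proof -
  have xQ: "x \<in> Q" using assms left_reps_in_span by blast
  have "x \<otimes>\<^bsub>P\<^esub> left_embed G g \<otimes>\<^bsub>P\<^esub> inv\<^bsub>P\<^esub> x \<in> Q \<longleftrightarrow> g \<in> G\<^sub>0" if g: "g \<in> carrier G" for g
  proof -
    have "inv\<^bsub>P\<^esub> x \<otimes>\<^bsub>P\<^esub> (x \<otimes>\<^bsub>P\<^esub> left_embed G g \<otimes>\<^bsub>P\<^esub> inv\<^bsub>P\<^esub> x) \<otimes>\<^bsub>P\<^esub> x = left_embed G g"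
      by (rule P.conj_cancel[OF span_closed(1)[OF xQ] left_embed_closed[OF g]])
    then have "x \<otimes>\<^bsub>P\<^esub> left_embed G g \<otimes>\<^bsub>P\<^esub> inv\<^bsub>P\<^esub> x \<in> Q \<longleftrightarrow> left_embed G g \<in> Q"
      using span_closed(2,3) xQ by metis
    then show ?thesis using left_embed_in_factors_span_iff[OF g] by simp
  qed
  moreover have "g \<in> carrier G" if "g \<in> G\<^sub>0" for g by (rule subgroup.mem_carrier[OF G0 that])
  ultimately show ?thesis unfolding conj_set_def by blast
qed

lemma right_letters_in_span:
  assumes "x \<in> {x \<in> Y. C \<inter> conj_set P x HP \<noteq> {[]}}"
  shows "C \<inter> conj_set P x HP \<inter> Q =
    conj_set P x (right_embed H ` {h \<in> H\<^sub>0. x \<otimes>\<^bsub>P\<^esub> right_embed H h \<otimes>\<^bsub>P\<^esub> inv\<^bsub>P\<^esub> x \<in> C})"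
proof -
  have xQ: "x \<in> Q" using assms right_reps_in_span by blast
  have "x \<otimes>\<^bsub>P\<^esub> right_embed H h \<otimes>\<^bsub>P\<^esub> inv\<^bsub>P\<^esub> x \<in> Q \<longleftrightarrow> h \<in> H\<^sub>0" if h: "h \<in> carrier H" for h
  proof -
    have "inv\<^bsub>P\<^esub> x \<otimes>\<^bsub>P\<^esub> (x \<otimes>\<^bsub>P\<^esub> right_embed H h \<otimes>\<^bsub>P\<^esub> inv\<^bsub>P\<^esub> x) \<otimes>\<^bsub>P\<^esub> x = right_embed H h"
      by (rule P.conj_cancel[OF span_closed(1)[OF xQ] right_embed_closed[OF h]])
    then have "x \<otimes>\<^bsub>P\<^esub> right_embed H h \<otimes>\<^bsub>P\<^esub> inv\<^bsub>P\<^esub> x \<in> Q \<longleftrightarrow> right_embed H h \<in> Q"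
      using span_closed(2,3) xQ by metis
    then show ?thesis using right_embed_in_factors_span_iff[OF h] by simp
  qed
  moreover have "h \<in> carrier H" if "h \<in> H\<^sub>0" for h by (rule subgroup.mem_carrier[OF H0 that])
  ultimately show ?thesis unfolding conj_set_def by blast
qed

text \<open>An element of \<open>C \<inter> Q\<close> is the product of the letters of a reduced
  word, and \<open>letters_in_span\<close> puts each letter into \<open>Q\<close>. Letters of the
  free part are generated by \<open>B\<close>; the others lie in the intersection of
  \<open>Q\<close> with a non-trivial factor.\<close>

lemma inter_span_eq:
  "C \<inter> Q = generate P
     (B \<union> (\<Union>x\<in>{x \<in> X. C \<inter> conj_set P x GP \<noteq> {[]}}.
             conj_set P x (left_embed G ` {g \<in> G\<^sub>0. x \<otimes>\<^bsub>P\<^esub> left_embed G g \<otimes>\<^bsub>P\<^esub> inv\<^bsub>P\<^esub> x \<in> C}))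
        \<union> (\<Union>y\<in>{y \<in> Y. C \<inter> conj_set P y HP \<noteq> {[]}}.
             conj_set P y (right_embed H ` {h \<in> H\<^sub>0. y \<otimes>\<^bsub>P\<^esub> right_embed H h \<otimes>\<^bsub>P\<^esub> inv\<^bsub>P\<^esub> y \<in> C})))"
proof -
  define X' where "X' = {x \<in> X. C \<inter> conj_set P x GP \<noteq> {[]}}"
  define Y' where "Y' = {y \<in> Y. C \<inter> conj_set P y HP \<noteq> {[]}}"
  \<comment> \<open>The generators are first handled as intersections with \<open>Q\<close>, where
    letters are easy to place; the form with conjugated subgroups is substituted at the end.\<close>
  define S where "S = B \<union> (\<Union>x\<in>X'. C \<inter> conj_set P x GP \<inter> Q) \<union> (\<Union>y\<in>Y'. C \<inter> conj_set P y HP \<inter> Q)"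
  have "F \<subseteq> C" using KF.factor_subset[of Free_Part] by simp
  moreover have "B \<subseteq> F" unfolding free_part_eq by (blast intro: generate.incl)
  ultimately have sub: "S \<subseteq> C \<inter> Q" unfolding S_def using basis_in_span by blast
  then have gen: "subgroup (generate P S) P"
    using subgroup.subset[OF C] by (intro P.generate_is_subgroup) blast
  have letter: "k \<in> generate P S"
    if i: "i \<in> indices" and k: "k \<in> factor i" "k \<noteq> []" "k \<in> Q" for i k
  proof (cases i)
    case Free_Part
    then have "k \<in> generate P B" using k(1) free_part_eq by simp
    moreover have "generate P B \<subseteq> generate P S" unfolding S_def by (rule P.mono_generate) blast
    ultimately show ?thesis by (rule rev_subsetD)
  next
    case (Left_Part x)
    then have "x \<in> X" "k \<in> C \<inter> conj_set P x GP" using i k(1) by auto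
    then have "k \<in> S" unfolding S_def X'_def using k(2,3) by blast
    then show ?thesis by (rule generate.incl)
  next
    case (Right_Part y)
    then have "y \<in> Y" "k \<in> C \<inter> conj_set P y HP" using i k(1) by auto
    then have "k \<in> S" unfolding S_def Y'_def using k(2,3) by blast
    then show ?thesis by (rule generate.incl)
  qed
  have "c \<in> generate P S" if c: "c \<in> C \<inter> Q" for c
  proof -
    obtain w where w: "KF.reduced w" "KF.word_val w = c"
      using c by (auto elim: KF.reduced_word_exists)
    then have wQ: "snd ` set w \<subseteq> Q" using letters_in_span c by blast
    have "snd a \<in> generate P S" if "a \<in> set w" for a
    proof (rule letter[of "fst a"])
      have "a \<in> Sigma indices (\<lambda>i. factor i - {[]})"
        using that w(1) by (auto simp: KF.reduced_def)
      then show "fst a \<in> indices" "snd a \<in> factor (fst a)" "snd a \<noteq> []" by auto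
      show "snd a \<in> Q" using wQ that by blast
    qed
    then have "set (map snd w) \<subseteq> generate P S" by auto
    from P.list_mult_in_subgroup[OF gen this] show ?thesis by (simp add: w(2))
  qed
  then have "C \<inter> Q = generate P S"
    using P.generate_subgroup_incl[OF sub P.subgroups_Inter_pair[OF C subgroup_factors_span]]
    by blast
  moreover have "S = B
      \<union> (\<Union>x\<in>X'. conj_set P x (left_embed G ` {g \<in> G\<^sub>0. x \<otimes>\<^bsub>P\<^esub> left_embed G g \<otimes>\<^bsub>P\<^esub> inv\<^bsub>P\<^esub> x \<in> C}))
      \<union> (\<Union>y\<in>Y'. conj_set P y (right_embed H ` {h \<in> H\<^sub>0. y \<otimes>\<^bsub>P\<^esub> right_embed H h \<otimes>\<^bsub>P\<^esub> inv\<^bsub>P\<^esub> y \<in> C}))"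
    unfolding S_def X'_def Y'_def
    by (intro arg_cong2[where f = "(\<union>)"] refl SUP_cong left_letters_in_span right_letters_in_span)
  ultimately show ?thesis unfolding X'_def Y'_def by simp
qed

end

section \<open>Finite families from a decomposition of finite rank\<close>

theorem theorem1p6:
  fixes G :: "('a, 'm) monoid_scheme" and H :: "('b, 'n) monoid_scheme"
    and C :: "('a + 'b) list set"
  assumes "group G" and "group H"
    and "carrier G \<noteq> {\<one>\<^bsub>G\<^esub>}" and "carrier H \<noteq> {\<one>\<^bsub>H\<^esub>}"
    and "subgroup C (free_product G H)" and "C \<noteq> carrier (free_product G H)"
    and "finite_kurosh_rank G H C"
  shows "\<exists>(\<Omega> :: ('a + 'b) list set) (I :: nat set) (J :: nat set) (K :: nat set)
            (\<zeta> :: nat \<Rightarrow> ('a + 'b) list) (\<alpha> :: nat \<Rightarrow> ('a + 'b) list) (\<beta> :: nat \<Rightarrow> ('a + 'b) list).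
           finite \<Omega> \<and> \<Omega> \<subseteq> carrier (free_product G H) \<and>
           finite I \<and> finite J \<and> finite K \<and>
           \<zeta> ` I \<subseteq> carrier (free_product G H) \<and>
           \<alpha> ` J \<subseteq> carrier (free_product G H) \<and>
           \<beta> ` K \<subseteq> carrier (free_product G H) \<and>
           (\<forall>G\<^sub>0 H\<^sub>0. subgroup G\<^sub>0 G \<longrightarrow> subgroup H\<^sub>0 H \<longrightarrow> \<Omega> \<subseteq> factors_span G H G\<^sub>0 H\<^sub>0 \<longrightarrow>
              (\<exists>(GG :: nat \<Rightarrow> 'a set) (HH :: nat \<Rightarrow> 'b set).
                 (\<forall>j\<in>J. subgroup (GG j) (G\<lparr>carrier := G\<^sub>0\<rparr>)) \<and>
                 (\<forall>k\<in>K. subgroup (HH k) (H\<lparr>carrier := H\<^sub>0\<rparr>)) \<and>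
                 C \<inter> factors_span G H G\<^sub>0 H\<^sub>0 =
                   generate (free_product G H)
                     (\<zeta> ` I
                      \<union> (\<Union>j\<in>J. conj_set (free_product G H) (\<alpha> j) (left_embed G ` GG j))
                      \<union> (\<Union>k\<in>K. conj_set (free_product G H) (\<beta> k) (right_embed H ` HH k)))))"
proof -
  interpret two_groups G H by (intro two_groups.intro assms)
  define GP :: "('a + 'b) list set" where "GP = left_embed G ` carrier G"
  define HP :: "('a + 'b) list set" where "HP = right_embed H ` carrier H"
  obtain n F B X Y where dec: "kurosh_decomposition G H C F X Y" and basis: "free_basis P F B"
    and n: "enat n = ecard B + ecard {x \<in> X. C \<inter> conj_set P x GP \<noteq> {[]}}
      + ecard {y \<in> Y. C \<inter> conj_set P y HP \<noteq> {[]}}"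
    using assms(7) unfolding finite_kurosh_rank_def has_kurosh_rank_def one_P GP_def HP_def by blast
  define X' where "X' = {x \<in> X. C \<inter> conj_set P x GP \<noteq> {[]}}"
  define Y' where "Y' = {y \<in> Y. C \<inter> conj_set P y HP \<noteq> {[]}}"
  have "finite S" if "ecard S \<noteq> \<infinity>" for S :: "('a + 'b) list set"
    using that by (auto simp: ecard_def split: if_splits)
  moreover have "enat n = ecard B + ecard X' + ecard Y'"
    using n unfolding X'_def Y'_def .
  \<comment> \<open>A sum in \<open>enat\<close> is infinite as soon as one summand is, so finite
    rank bounds all three sets.\<close>
  then have "ecard B \<noteq> \<infinity>" "ecard X' \<noteq> \<infinity>" "ecard Y' \<noteq> \<infinity>"
    by (metis enat.distinct(1) plus_enat_simps(2,3))+
  ultimately have fin: "finite B" "finite X'" "finite Y'" by blast+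
  have carr: "B \<subseteq> carrier P" "X' \<subseteq> carrier P" "Y' \<subseteq> carrier P"
    using basis dec
    by (auto simp: free_basis_def X'_def Y'_def kurosh_decomposition_def double_coset_reps_def)
  \<comment> \<open>The index sets are sets of natural numbers, so each finite set is turned into
    the image of an initial segment.\<close>
  have enum: "\<exists>(M :: nat set) f. finite M \<and> f ` M = S" if S: "finite S" for S :: "('a + 'b) list set"
  proof -
    obtain m f where "S = f ` {i :: nat. i < m}"
      using finite_imp_nat_seg_image_inj_on[OF S] by blast
    then show ?thesis by (intro exI[of _ "{i. i < m}"] exI[of _ f]) simp
  qed
  obtain I :: "nat set" and \<zeta> where \<zeta>: "finite I" "\<zeta> ` I = B"
    using enum[OF fin(1)] by blast
  obtain J :: "nat set" and \<alpha> where \<alpha>: "finite J" "\<alpha> ` J = X'"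
    using enum[OF fin(2)] by blast
  obtain K :: "nat set" and \<beta> where \<beta>: "finite K" "\<beta> ` K = Y'"
    using enum[OF fin(3)] by blast
  \<comment> \<open>The families are already fixed at this point; only the subgroups
    \<open>GG\<close> and \<open>HH\<close> may depend on \<open>G\<^sub>0\<close> and
    \<open>H\<^sub>0\<close>.\<close>
  have main: "\<exists>(GG :: nat \<Rightarrow> 'a set) (HH :: nat \<Rightarrow> 'b set).
      (\<forall>j\<in>J. subgroup (GG j) (G\<lparr>carrier := G\<^sub>0\<rparr>)) \<and>
      (\<forall>k\<in>K. subgroup (HH k) (H\<lparr>carrier := H\<^sub>0\<rparr>)) \<and>
      C \<inter> factors_span G H G\<^sub>0 H\<^sub>0 =
        generate P (\<zeta> ` I \<union> (\<Union>j\<in>J. conj_set P (\<alpha> j) (left_embed G ` GG j))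
                           \<union> (\<Union>k\<in>K. conj_set P (\<beta> k) (right_embed H ` HH k)))"
    if "subgroup G\<^sub>0 G" "subgroup H\<^sub>0 H" "B \<union> X' \<union> Y' \<subseteq> factors_span G H G\<^sub>0 H\<^sub>0" for G\<^sub>0 H\<^sub>0
  proof -
    interpret kurosh_in_span G H G\<^sub>0 H\<^sub>0 C F B X Y
      using that assms(5) dec basis
      by (intro kurosh_in_span.intro kurosh_in_span_axioms.intro two_subgroups.intro
            two_subgroups_axioms.intro two_groups_axioms)
         (simp_all add: X'_def Y'_def GP_def HP_def)
    \<comment> \<open>For \<open>x\<close> in \<open>X'\<close>, conjugating the image of
      \<open>L x\<close> by \<open>x\<close> gives the part of the factor of \<open>x\<close> inside
      the span; \<open>R\<close> does the same for \<open>Y'\<close>.\<close>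
    define L where "L x = {g \<in> G\<^sub>0. x \<otimes>\<^bsub>P\<^esub> left_embed G g \<otimes>\<^bsub>P\<^esub> inv\<^bsub>P\<^esub> x \<in> C}" for x
    define R where "R y = {h \<in> H\<^sub>0. y \<otimes>\<^bsub>P\<^esub> right_embed H h \<otimes>\<^bsub>P\<^esub> inv\<^bsub>P\<^esub> y \<in> C}" for y
    have L: "subgroup (L x) (G\<lparr>carrier := G\<^sub>0\<rparr>)" if "x \<in> X'" for x
      unfolding L_def
      by (rule group_hom.conj_preimage_subgroup[OF group_hom_left_embed \<open>subgroup G\<^sub>0 G\<close> assms(5)
            subsetD[OF carr(2) that]])
    have R: "subgroup (R y) (H\<lparr>carrier := H\<^sub>0\<rparr>)" if "y \<in> Y'" for y
      unfolding R_def
      by (rule group_hom.conj_preimage_subgroup[OF group_hom_right_embed \<open>subgroup H\<^sub>0 H\<close> assms(5)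
            subsetD[OF carr(3) that]])
    have "C \<inter> factors_span G H G\<^sub>0 H\<^sub>0 =
        generate P (B \<union> (\<Union>x\<in>X'. conj_set P x (left_embed G ` L x))
                      \<union> (\<Union>y\<in>Y'. conj_set P y (right_embed H ` R y)))"
      unfolding X'_def Y'_def L_def R_def GP_def HP_def by (rule inter_span_eq)
    then have "C \<inter> factors_span G H G\<^sub>0 H\<^sub>0 =
        generate P (\<zeta> ` I \<union> (\<Union>j\<in>J. conj_set P (\<alpha> j) (left_embed G ` L (\<alpha> j)))
                           \<union> (\<Union>k\<in>K. conj_set P (\<beta> k) (right_embed H ` R (\<beta> k))))"
      unfolding \<zeta>(2) \<alpha>(2)[symmetric] \<beta>(2)[symmetric] image_image .
    moreover have "\<forall>j\<in>J. subgroup (L (\<alpha> j)) (G\<lparr>carrier := G\<^sub>0\<rparr>)" using L \<alpha>(2) by blast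
    moreover have "\<forall>k\<in>K. subgroup (R (\<beta> k)) (H\<lparr>carrier := H\<^sub>0\<rparr>)" using R \<beta>(2) by blast
    ultimately show ?thesis
      by (intro exI[of _ "\<lambda>j. L (\<alpha> j)"] exI[of _ "\<lambda>k. R (\<beta> k)"] conjI)
  qed
  show ?thesis
  proof (rule exI[of _ "B \<union> X' \<union> Y'"], rule exI[of _ I], rule exI[of _ J], rule exI[of _ K],
      rule exI[of _ \<zeta>], rule exI[of _ \<alpha>], rule exI[of _ \<beta>], intro conjI allI impI)
    show "finite (B \<union> X' \<union> Y')" "B \<union> X' \<union> Y' \<subseteq> carrier P" using fin carr by blast+
    show "finite I" "finite J" "finite K" by fact+
    show "\<zeta> ` I \<subseteq> carrier P" "\<alpha> ` J \<subseteq> carrier P" "\<beta> ` K \<subseteq> carrier P"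
      unfolding \<zeta>(2) \<alpha>(2) \<beta>(2) by fact+
  qed (rule main)
qed

end
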